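(* Let $\rho>0$ and let $f:\mathbb{R}^n\to\mathbb{R}$, $g:\mathbb{R}^n\to\mathbb{R}^m$, $h:\mathbb{R}^n\to\mathbb{R}^p$ be continuously differentiable. Let $x^*\in\mathbb{R}^n$, $\lambda^*\in\mathbb{R}^m$, $\mu^*\in\mathbb{R}^p$. The following are equivalent: (i) $x^*$ is S-stationary for (SPO) with multipliers $(\lambda^*,\mu^* )$. (ii) There exists $(y^*,\gamma^*,\sigma^* )\in\mathbb{R}^n\times\mathbb{R}^n\times\mathbb{R}^n$, depending on $(x^*,\lambda^*,\mu^* )$ only, such that $(x^*,y^*,\lambda^*,\mu^*,\gamma^*,\sigma^* )$ is a KKT point of (SPOlin). (iii) There exists $(y^*,\gamma^* )\in\mathbb{R}^n\times\mathbb{R}^n$, depending on $(x^*,\lambda^*,\mu^* )$ only, such that $(x^*,y^*,\lambda^*,\mu^*,\gamma^* )$ is a KKT point of (SPOsq).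
   Context: $X=\{x\in\mathbb{R}^n\mid g(x)\le 0,\ h(x)=0\}$; $\|x\|_0$ is the number of nonzero components of $x$; $e=(1,\dots,1)^T\in\mathbb{R}^n$; $\circ$ is the componentwise product; $I_0(x)=\{i\mid x_i=0\}$; $L^{SP}(x,\lambda,\mu)=f(x)+\lambda^Tg(x)+\mu^Th(x)$. Problems: (SPO): $\min_x f(x)+\rho\|x\|_0$ s.t. $x\in X$. (SPOlin): $\min_{(x,y)} f(x)+\rho(n-e^Ty)$ s.t. $x\in X$, $x\circ y=0$, $y\le e$. (SPOsq): $\min_{(x,y)} f(x)+\frac{\rho}{2}\sum_{i=1}^n y_i(y_i-2)$ s.t. $x\in X$, $x\circ y=0$. $x^*$ is S-stationary (strongly stationary) for (SPO) with multipliers $(\lambda^*,\mu^* )$ if $\nabla_{x_i}L^{SP}(x^*,\lambda^*,\mu^* )=0$ for all $i\notin I_0(x^* )$; $\lambda^*\ge0$, $g(x^* )\le0$, $\lambda^*\circ g(x^* )=0$; and $h(x^* )=0$. $(x,y,\lambda,\mu,\gamma,\sigma)$ is a KKT point of (SPOlin) if: $\nabla_xL^{SP}(x,\lambda,\mu)+\gamma\circ y=0$; $-\rho e+\gamma\circ x+\sigma=0$; $\lambda\ge0$, $g(x)\le0$, $\lambda\circ g(x)=0$; $h(x)=0$; $x\circ y=0$; $\sigma\ge0$, $y\le e$, $\sigma\circ(y-e)=0$. $(x,y,\lambda,\mu,\gamma)$ is a KKT point of (SPOsq) if: $\nabla_xL^{SP}(x,\lambda,\mu)+\gamma\circ y=0$;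 $\rho(y-e)+\gamma\circ x=0$; $\lambda\ge0$, $g(x)\le0$, $\lambda\circ g(x)=0$; $h(x)=0$; $x\circ y=0$. *)

theory Defs
  imports "HOL-Analysis.Analysis"
begin

text \<open>
  Vectors in Euclidean n-space have type \<open>real ^ 'n\<close>. On this type the library's \<open>\<le>\<close> is
  the componentwise order, \<open>*\<close> is the componentwise product and \<open>1\<close> is the vector
  \<open>e = (1, ..., 1)\<close>; these are the operations used below.
\<close>

definition cont_diff :: "('a::real_normed_vector \<Rightarrow> 'b::real_normed_vector) \<Rightarrow> bool" where
  "cont_diff f \<longleftrightarrow>
     (\<exists>f' :: 'a \<Rightarrow> 'a \<Rightarrow>\<^sub>L 'b.
        (\<forall>x. (f has_derivative blinfun_apply (f' x)) (at x)) \<and> continuous_on UNIV f')"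

text \<open>Meaningful only at points where \<open>F\<close> is differentiable.\<close>

definition grad :: "('a::real_inner \<Rightarrow> real) \<Rightarrow> 'a \<Rightarrow> 'a" where
  "grad F x = (THE D. GDERIV F x :> D)"

definition zero_index :: "real ^ 'n \<Rightarrow> 'n set" where
  "zero_index x = {i. x $ i = 0}"

definition lagrangian_SP ::
  "(real ^ 'n \<Rightarrow> real) \<Rightarrow> (real ^ 'n \<Rightarrow> real ^ 'm) \<Rightarrow> (real ^ 'n \<Rightarrow> real ^ 'p) \<Rightarrow>
   real ^ 'n \<Rightarrow> real ^ 'm \<Rightarrow> real ^ 'p \<Rightarrow> real" where
  "lagrangian_SP f g h x l u = f x + l \<bullet> g x + u \<bullet> h x"

definition grad_lagrangian_SP ::
  "(real ^ 'n \<Rightarrow> real) \<Rightarrow> (real ^ 'n \<Rightarrow> real ^ 'm) \<Rightarrow> (real ^ 'n \<Rightarrow> real ^ 'p) \<Rightarrow>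
   real ^ 'n \<Rightarrow> real ^ 'm \<Rightarrow> real ^ 'p \<Rightarrow> real ^ 'n" where
  "grad_lagrangian_SP f g h x l u = grad (\<lambda>z. lagrangian_SP f g h z l u) x"

text \<open>
  Strong stationarity for (SPO): minimise \<open>f x + \<rho> * card {i. x $ i \<noteq> 0}\<close> subject to
  \<open>g x \<le> 0\<close>, \<open>h x = 0\<close>. The condition does not involve \<open>\<rho>\<close>.
\<close>

definition S_stationary ::
  "(real ^ 'n \<Rightarrow> real) \<Rightarrow> (real ^ 'n \<Rightarrow> real ^ 'm) \<Rightarrow> (real ^ 'n \<Rightarrow> real ^ 'p) \<Rightarrow>
   real ^ 'n \<Rightarrow> real ^ 'm \<Rightarrow> real ^ 'p \<Rightarrow> bool" where
  "S_stationary f g h x l u \<longleftrightarrow>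
     (\<forall>i. i \<notin> zero_index x \<longrightarrow> grad_lagrangian_SP f g h x l u $ i = 0) \<and>
     l \<ge> 0 \<and> g x \<le> 0 \<and> l * g x = 0 \<and>
     h x = 0"

text \<open>
  KKT conditions for (SPOlin): minimise \<open>f x + \<rho> * (n - 1 \<bullet> y)\<close> over \<open>(x, y)\<close> subject to
  \<open>g x \<le> 0\<close>, \<open>h x = 0\<close>, \<open>x * y = 0\<close>, \<open>y \<le> 1\<close>. The multiplier \<open>c\<close> (gamma) belongs to
  \<open>x * y = 0\<close> and \<open>s\<close> (sigma) to \<open>y \<le> 1\<close>.
\<close>

definition KKT_SPOlin ::
  "real \<Rightarrow> (real ^ 'n \<Rightarrow> real) \<Rightarrow> (real ^ 'n \<Rightarrow> real ^ 'm) \<Rightarrow> (real ^ 'n \<Rightarrow> real ^ 'p) \<Rightarrow>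
   real ^ 'n \<Rightarrow> real ^ 'n \<Rightarrow> real ^ 'm \<Rightarrow> real ^ 'p \<Rightarrow> real ^ 'n \<Rightarrow> real ^ 'n \<Rightarrow> bool" where
  "KKT_SPOlin \<rho> f g h x y l u c s \<longleftrightarrow>
     grad_lagrangian_SP f g h x l u + c * y = 0 \<and>
     - (\<rho> *\<^sub>R 1) + c * x + s = 0 \<and>
     l \<ge> 0 \<and> g x \<le> 0 \<and> l * g x = 0 \<and>
     h x = 0 \<and>
     x * y = 0 \<and>
     s \<ge> 0 \<and> y \<le> 1 \<and> s * (y - 1) = 0"

text \<open>
  KKT conditions for (SPOsq): minimise \<open>f x + \<rho> / 2 * (\<Sum>i\<in>UNIV. y $ i * (y $ i - 2))\<close> over
  \<open>(x, y)\<close> subject to \<open>g x \<le> 0\<close>, \<open>h x = 0\<close>, \<open>x * y = 0\<close>.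
\<close>

definition KKT_SPOsq ::
  "real \<Rightarrow> (real ^ 'n \<Rightarrow> real) \<Rightarrow> (real ^ 'n \<Rightarrow> real ^ 'm) \<Rightarrow> (real ^ 'n \<Rightarrow> real ^ 'p) \<Rightarrow>
   real ^ 'n \<Rightarrow> real ^ 'n \<Rightarrow> real ^ 'm \<Rightarrow> real ^ 'p \<Rightarrow> real ^ 'n \<Rightarrow> bool" where
  "KKT_SPOsq \<rho> f g h x y l u c \<longleftrightarrow>
     grad_lagrangian_SP f g h x l u + c * y = 0 \<and>
     \<rho> *\<^sub>R (y - 1) + c * x = 0 \<and>
     l \<ge> 0 \<and> g x \<le> 0 \<and> l * g x = 0 \<and>
     h x = 0 \<and>
     x * y = 0"

end

theory Submission
  imports Defs
begin

text \<open>
  Write \<open>D\<close> for the gradient of the Lagrangian. All three systems contain the conditions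
  \<open>l \<ge> 0\<close>, \<open>g x \<le> 0\<close>, \<open>l * g x = 0\<close>, \<open>h x = 0\<close>, and what remains decouples
  into scalar systems, one per index. If \<open>x $ i = 0\<close>, the equation obtained by differentiating in
  \<open>y $ i\<close> forces \<open>y $ i = 1\<close> (for the linear model because it gives \<open>s $ i = \<rho> > 0\<close>, and
  complementarity makes the bound active), and the equation in \<open>x $ i\<close> is then solved by
  \<open>c $ i = - D $ i\<close>, whatever \<open>D $ i\<close> is. If \<open>x $ i \<noteq> 0\<close>, orthogonality forces
  \<open>y $ i = 0\<close>, hence \<open>c $ i = \<rho> / x $ i\<close> (and \<open>s $ i = 0\<close>), and the equation in
  \<open>x $ i\<close> becomes \<open>D $ i = 0\<close>, which is precisely S-stationarity at \<open>i\<close>. Each KKT system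
  is therefore equivalent to S-stationarity together with explicit formulas for \<open>y\<close>,
  \<open>c\<close>, \<open>s\<close> (\<open>KKT_SPOlin_iff_S_stationary\<close>, \<open>KKT_SPOsq_iff_S_stationary\<close>), and
  existence and uniqueness both follow.
\<close>

text \<open>The vector \<open>y\<close> common to both KKT systems: the indicator of the zero components of \<open>x\<close>.\<close>

definition zero_indicator :: "real ^ 'n \<Rightarrow> real ^ 'n" where
  "zero_indicator x = (\<chi> i. if x $ i = 0 then 1 else 0)"

text \<open>
  The multiplier \<open>c\<close> of the constraint \<open>x * y = 0\<close>, common to both KKT systems; the vector
  \<open>d\<close> stands for the gradient of the Lagrangian at \<open>x\<close>.
\<close>

definition orth_multiplier :: "real \<Rightarrow> real ^ 'n \<Rightarrow> real ^ 'n \<Rightarrow> real ^ 'n" where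
  "orth_multiplier \<rho> d x = (\<chi> i. if x $ i = 0 then - d $ i else \<rho> / x $ i)"

lemma scalar_KKT_lin_iff:
  fixes \<rho> d x y c s :: real
  assumes "\<rho> > 0"
  shows "d + c * y = 0 \<and> - \<rho> + c * x + s = 0 \<and> x * y = 0 \<and> s \<ge> 0 \<and> y \<le> 1 \<and> s * (y - 1) = 0
    \<longleftrightarrow> (x \<noteq> 0 \<longrightarrow> d = 0) \<and> y = (if x = 0 then 1 else 0) \<and>
        c = (if x = 0 then - d else \<rho> / x) \<and> s = \<rho> * (if x = 0 then 1 else 0)"
  using assms by (cases "x = 0") (auto simp: field_simps)

lemma scalar_KKT_sq_iff:
  fixes \<rho> d x y c :: real
  assumes "\<rho> > 0"
  shows "d + c * y = 0 \<and> \<rho> * (y - 1) + c * x = 0 \<and> x * y = 0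
    \<longleftrightarrow> (x \<noteq> 0 \<longrightarrow> d = 0) \<and> y = (if x = 0 then 1 else 0) \<and>
        c = (if x = 0 then - d else \<rho> / x)"
  using assms by (cases "x = 0") (auto simp: field_simps)

lemma KKT_SPOlin_iff_S_stationary:
  assumes "\<rho> > 0"
  shows "KKT_SPOlin \<rho> f g h x y l u c s \<longleftrightarrow>
    S_stationary f g h x l u \<and> y = zero_indicator x \<and>
    c = orth_multiplier \<rho> (grad_lagrangian_SP f g h x l u) x \<and> s = \<rho> *\<^sub>R zero_indicator x"
proof -
  define d where "d = grad_lagrangian_SP f g h x l u"
  have "d + c * y = 0 \<and> - (\<rho> *\<^sub>R 1) + c * x + s = 0 \<and> x * y = 0 \<and> s \<ge> 0 \<and> y \<le> 1 \<and>
      s * (y - 1) = 0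
    \<longleftrightarrow> (\<forall>i. d $ i + c $ i * y $ i = 0 \<and> - \<rho> + c $ i * x $ i + s $ i = 0 \<and> x $ i * y $ i = 0 \<and>
      s $ i \<ge> 0 \<and> y $ i \<le> 1 \<and> s $ i * (y $ i - 1) = 0)"
    by (simp add: vec_eq_iff less_eq_vec_def all_conj_distrib del: mult_eq_0_iff)
  also have "\<dots> \<longleftrightarrow> (\<forall>i. i \<notin> zero_index x \<longrightarrow> d $ i = 0) \<and> y = zero_indicator x \<and>
      c = orth_multiplier \<rho> d x \<and> s = \<rho> *\<^sub>R zero_indicator x"
    unfolding scalar_KKT_lin_iff[OF assms]
    by (simp only: vec_eq_iff all_conj_distrib zero_index_def zero_indicator_def
        orth_multiplier_def mem_Collect_eq vec_lambda_beta vector_scaleR_component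
        real_scaleR_def)
  finally show ?thesis
    unfolding KKT_SPOlin_def S_stationary_def d_def by blast
qed

lemma KKT_SPOsq_iff_S_stationary:
  assumes "\<rho> > 0"
  shows "KKT_SPOsq \<rho> f g h x y l u c \<longleftrightarrow>
    S_stationary f g h x l u \<and> y = zero_indicator x \<and>
    c = orth_multiplier \<rho> (grad_lagrangian_SP f g h x l u) x"
proof -
  define d where "d = grad_lagrangian_SP f g h x l u"
  have "d + c * y = 0 \<and> \<rho> *\<^sub>R (y - 1) + c * x = 0 \<and> x * y = 0
    \<longleftrightarrow> (\<forall>i. d $ i + c $ i * y $ i = 0 \<and> \<rho> * (y $ i - 1) + c $ i * x $ i = 0 \<and>
      x $ i * y $ i = 0)"
    by (simp add: vec_eq_iff all_conj_distrib del: mult_eq_0_iff)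
  also have "\<dots> \<longleftrightarrow> (\<forall>i. i \<notin> zero_index x \<longrightarrow> d $ i = 0) \<and> y = zero_indicator x \<and>
      c = orth_multiplier \<rho> d x"
    unfolding scalar_KKT_sq_iff[OF assms]
    by (simp only: vec_eq_iff all_conj_distrib zero_index_def zero_indicator_def
        orth_multiplier_def mem_Collect_eq vec_lambda_beta)
  finally show ?thesis
    unfolding KKT_SPOsq_def S_stationary_def d_def by blast
qed

theorem theorem4p3:
  fixes \<rho> :: real
    and f :: "real ^ 'n \<Rightarrow> real"
    and g :: "real ^ 'n \<Rightarrow> real ^ 'm"
    and h :: "real ^ 'n \<Rightarrow> real ^ 'p"
    and x :: "real ^ 'n" and l :: "real ^ 'm" and u :: "real ^ 'p"
  assumes "\<rho> > 0" and "cont_diff f" and "cont_diff g" and "cont_diff h"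
  shows "(S_stationary f g h x l u \<longleftrightarrow> (\<exists>y c s. KKT_SPOlin \<rho> f g h x y l u c s)) \<and>
         (S_stationary f g h x l u \<longleftrightarrow> (\<exists>y c. KKT_SPOsq \<rho> f g h x y l u c)) \<and>
         (\<forall>y c s y' c' s'. KKT_SPOlin \<rho> f g h x y l u c s \<longrightarrow> KKT_SPOlin \<rho> f g h x y' l u c' s' \<longrightarrow>
            y = y' \<and> c = c' \<and> s = s') \<and>
         (\<forall>y c y' c'. KKT_SPOsq \<rho> f g h x y l u c \<longrightarrow> KKT_SPOsq \<rho> f g h x y' l u c' \<longrightarrow>
            y = y' \<and> c = c')"
  unfolding KKT_SPOlin_iff_S_stationary[OF assms(1)] KKT_SPOsq_iff_S_stationary[OF assms(1)]
  by blast

end
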